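(* Let $E$ be a separable Banach space, $x_0\in L_\infty(\Omega,E)$, and let $f:\Omega\times E\to\overline{\mathbb{R}}$ be a measurable integrand with $f(x_0)$ integrable. Suppose that there exist $\eta>0$ and an integrable function $c$ such that, for almost every $\omega$ and every $e\in E$, $$\|e\|\le\eta\ \Longrightarrow\ f_\omega(x_0(\omega)+e)-f_\omega(x_0(\omega))\ge-c(\omega)\|e\| .$$ Then $$L_1(\partial^Ff(x_0))_{\sigma^*}\subset\partial^FI_f(x_0).$$
   Context: $(\Omega,\mathbb{T},\mu)$ is a measure space with $\mu$ a $\sigma$-finite positive measure and $\mathbb{T}$ $\mu$-complete. A measurable integrand is a $\mathbb{T}\otimes\mathcal{B}(E)$-measurable function; $f_\omega=f(\omega,\cdot)$; $f(x_0)$ is the function $\omega\mapsto f(\omega,x_0(\omega))$. $I_f(x)=\int^*_\Omega f(\omega,x(\omega))\,d\mu(\omega)$, considered on $L_\infty(\Omega,E)$, with $\int^*_\Omega v\,d\mu=\inf\{\int_\Omega u\,d\mu: u\in L_1(\Omega,\mathbb{R}),\ u\ge v\text{ a.e.}\}$. For a function $J$ on a normed space $Y$ finite at $y_0$, the Fréchet subdifferential is $\partial^FJ(y_0)=\{y^*\in Y^*: \liminf_{y\to y_0}\frac{J(y)-J(y_0)-\langle y^*,y-y_0\rangle}{\|y-y_0\|}\ge0\}$. $L_1(\Omega,E^*_{\sigma^*})$ is the set of classes of scalarly measurable $x^*:\Omega\to E^*$ with $\|x^*\|_*\in L_1(\Omega,\mathbb{R})$, identified with functionals on $L_\infty(\Omega,E)$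 via $\langle x^*,x\rangle=\int_\Omega\langle x^*(\omega),x(\omega)\rangle\,d\mu$. $L_1(\partial^Ff(x_0))_{\sigma^*}$ is the set of $x^*\in L_1(\Omega,E^*_{\sigma^*})$ with $x^*(\omega)\in\partial^Ff_\omega(x_0(\omega))$ for almost every $\omega$. *)

theory Defs
  imports
    "HOL-Analysis.Analysis"
    "HOL-Library.Function_Algebras"
    "HOL-Probability.Essential_Supremum"
begin

text \<open>
  The library has no Lebesgue spaces over an arbitrary measure as types. Elements of
  \<open>L\<^sub>\<infinity>(\<Omega>, E)\<close> and \<open>L\<^sub>1(\<Omega>, E\<^sup>*)\<close> are therefore represented by functions, not by classes of a.e.
  equal functions, inside the vector space of all functions with pointwise operations. To treat
  \<open>L\<^sub>\<infinity>\<close> and an ordinary normed space alike, a normed space is given by a carrier \<open>Y\<close> and a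
  (semi)norm \<open>N\<close> on it; the genuine space is the quotient of \<open>Y\<close> by \<open>{y. N y = 0}\<close>.
\<close>

instantiation "fun" :: (type, real_vector) real_vector
begin

definition scaleR_fun :: "real \<Rightarrow> ('a \<Rightarrow> 'b) \<Rightarrow> 'a \<Rightarrow> 'b"
  where "scaleR_fun r f = (\<lambda>x. r *\<^sub>R f x)"

instance
  by standard (simp_all add: fun_eq_iff scaleR_fun_def scaleR_add_right scaleR_add_left)

end

text \<open>Continuous linear functionals on \<open>(Y, N)\<close>; their values outside \<open>Y\<close> are irrelevant. The bound
  makes them invariant under a change of representative.\<close>

definition dual_on :: "'v::real_vector set \<Rightarrow> ('v \<Rightarrow> real) \<Rightarrow> ('v \<Rightarrow> real) set"
  where "dual_on Y N = {l.
    (\<forall>x\<in>Y. \<forall>y\<in>Y. l (x + y) = l x + l y) \<and>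
    (\<forall>r. \<forall>x\<in>Y. l (r *\<^sub>R x) = r * l x) \<and>
    (\<exists>K. \<forall>x\<in>Y. \<bar>l x\<bar> \<le> K * N x)}"

text \<open>The filter of \<open>y \<rightarrow> y0\<close> within \<open>Y\<close>. The punctured \<open>at_right 0\<close> excludes exactly the \<open>y\<close>
  that represent the same point as \<open>y0\<close>.\<close>

definition at_on :: "'v::real_vector set \<Rightarrow> ('v \<Rightarrow> real) \<Rightarrow> 'v \<Rightarrow> 'v filter"
  where "at_on Y N y0 = inf (filtercomap (\<lambda>y. N (y - y0)) (at_right 0)) (principal Y)"

definition frechet_subdifferential ::
    "'v::real_vector set \<Rightarrow> ('v \<Rightarrow> real) \<Rightarrow> ('v \<Rightarrow> ereal) \<Rightarrow> 'v \<Rightarrow> ('v \<Rightarrow> real) set"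
  where "frechet_subdifferential Y N J y0 = {l \<in> dual_on Y N.
    \<bar>J y0\<bar> \<noteq> \<infinity> \<and>
    0 \<le> Liminf (at_on Y N y0) (\<lambda>y. (J y - J y0 - ereal (l (y - y0))) / ereal (N (y - y0)))}"

lemma at_on_UNIV_norm: "at_on UNIV norm y0 = at (y0 :: 'e::real_normed_vector)"
proof -
  have "eventually P (at_on UNIV norm y0) \<longleftrightarrow> eventually P (at y0)" for P
  proof
    assume "eventually P (at_on UNIV norm y0)"
    then obtain Q where Q: "eventually Q (at_right (0::real))" "\<And>y. Q (norm (y - y0)) \<Longrightarrow> P y"
      by (auto simp: at_on_def eventually_filtercomap)
    obtain b where b: "b > 0" "\<And>t. t > 0 \<Longrightarrow> t < b \<Longrightarrow> Q t"
      using Q(1) unfolding eventually_at_right_field by auto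
    show "eventually P (at y0)"
      unfolding eventually_at using b Q(2) by (intro exI[of _ b]) (auto simp: dist_norm)
  next
    assume "eventually P (at y0)"
    then obtain d where d: "d > 0" "\<And>y. y \<noteq> y0 \<Longrightarrow> dist y y0 < d \<Longrightarrow> P y"
      unfolding eventually_at by auto
    have "eventually (\<lambda>t. 0 < t \<and> t < d) (at_right (0::real))"
      unfolding eventually_at_right_field using d(1) by auto
    moreover have "P y" if "0 < norm (y - y0) \<and> norm (y - y0) < d" for y
      using that d(2)[of y] by (auto simp: dist_norm)
    ultimately show "eventually P (at_on UNIV norm y0)"
      unfolding at_on_def by (auto simp: eventually_filtercomap)
  qed
  then show ?thesis
    by (simp add: filter_eq_iff)
qed

lemma dual_on_UNIV_norm:
  "dual_on UNIV norm = range (blinfun_apply :: ('e::real_normed_vector \<Rightarrow>\<^sub>L real) \<Rightarrow> 'e \<Rightarrow> real)"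
proof (intro set_eqI iffI)
  fix l :: "'e \<Rightarrow> real"
  assume "l \<in> dual_on UNIV norm"
  then obtain K where "\<And>x y. l (x + y) = l x + l y" "\<And>r x. l (r *\<^sub>R x) = r * l x"
    "\<And>x. \<bar>l x\<bar> \<le> K * norm x"
    by (auto simp: dual_on_def)
  then have "bounded_linear l"
    by (intro bounded_linear_intro[of l K]) (auto simp: mult.commute)
  then show "l \<in> range blinfun_apply"
    by (metis bounded_linear_Blinfun_apply rangeI)
next
  fix l :: "'e \<Rightarrow> real"
  assume "l \<in> range blinfun_apply"
  then obtain L :: "'e \<Rightarrow>\<^sub>L real" where L: "l = blinfun_apply L" by auto
  have "\<bar>L x\<bar> \<le> norm L * norm x" for x
    using norm_blinfun[of L x] by simp
  then show "l \<in> dual_on UNIV norm"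
    by (auto simp: dual_on_def L blinfun.add_right blinfun.scaleR_right)
qed

text \<open>On an honest normed space this is the usual Frechet subdifferential.\<close>

lemma frechet_subdifferential_UNIV_norm:
  fixes l :: "'e::real_normed_vector \<Rightarrow>\<^sub>L real"
  shows "blinfun_apply l \<in> frechet_subdifferential UNIV norm J y0 \<longleftrightarrow>
    \<bar>J y0\<bar> \<noteq> \<infinity> \<and>
    0 \<le> Liminf (at y0) (\<lambda>y. (J y - J y0 - ereal (l (y - y0))) / ereal (norm (y - y0)))"
  by (simp add: frechet_subdifferential_def at_on_UNIV_norm dual_on_UNIV_norm)

text \<open>On the null measure \<open>esssup\<close> is \<open>-\<infinity>\<close>, which \<open>real_of_ereal\<close> sends to \<open>0\<close>, as it should.
  For separable \<open>E\<close>, Borel measurability is the same as strong measurability.\<close>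

definition Linf :: "'w measure \<Rightarrow> ('w \<Rightarrow> 'e::real_normed_vector) set"
  where "Linf M = {x \<in> borel_measurable M. esssup M (\<lambda>w. ereal (norm (x w))) < \<infinity>}"

definition Linf_norm :: "'w measure \<Rightarrow> ('w \<Rightarrow> 'e::real_normed_vector) \<Rightarrow> real"
  where "Linf_norm M x = real_of_ereal (esssup M (\<lambda>w. ereal (norm (x w))))"

definition ereal_integrable :: "'w measure \<Rightarrow> ('w \<Rightarrow> ereal) \<Rightarrow> bool"
  where "ereal_integrable M g \<longleftrightarrow>
    g \<in> borel_measurable M \<and> (\<integral>\<^sup>+w. e2ennreal \<bar>g w\<bar> \<partial>M) < \<infinity>"

definition measurable_integrand ::
    "'w measure \<Rightarrow> ('w \<Rightarrow> 'e::real_normed_vector \<Rightarrow> ereal) \<Rightarrow> bool"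
  where "measurable_integrand M f \<longleftrightarrow> (\<lambda>(w, e). f w e) \<in> borel_measurable (M \<Otimes>\<^sub>M borel)"

definition upper_integral :: "'w measure \<Rightarrow> ('w \<Rightarrow> ereal) \<Rightarrow> ereal"
  where "upper_integral M v =
    Inf {ereal (\<integral>w. u w \<partial>M) | u. integrable M u \<and> (AE w in M. v w \<le> ereal (u w))}"

definition integral_functional ::
    "'w measure \<Rightarrow> ('w \<Rightarrow> 'e::real_normed_vector \<Rightarrow> ereal) \<Rightarrow> ('w \<Rightarrow> 'e) \<Rightarrow> ereal"
  where "integral_functional M f x = upper_integral M (\<lambda>w. f w (x w))"

text \<open>\<open>L\<^sub>1(\<Omega>, E\<^sup>*)\<close> in the weak-star sense: \<open>x\<^sup>*\<close> itself need not be Borel measurable, only the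
  scalar functions \<open>\<langle>x\<^sup>*(\<cdot>), e\<rangle>\<close> and the dual norm.\<close>

definition L1_weak_star :: "'w measure \<Rightarrow> ('w \<Rightarrow> 'e::real_normed_vector \<Rightarrow>\<^sub>L real) set"
  where "L1_weak_star M = {xs.
    (\<forall>e. (\<lambda>w. blinfun_apply (xs w) e) \<in> borel_measurable M) \<and>
    integrable M (\<lambda>w. norm (xs w))}"

definition L1_functional ::
    "'w measure \<Rightarrow> ('w \<Rightarrow> 'e::real_normed_vector \<Rightarrow>\<^sub>L real) \<Rightarrow> ('w \<Rightarrow> 'e) \<Rightarrow> real"
  where "L1_functional M xs x = (\<integral>w. blinfun_apply (xs w) (x w) \<partial>M)"

definition L1_frechet_subdifferential ::
    "'w measure \<Rightarrow> ('w \<Rightarrow> 'e::real_normed_vector \<Rightarrow> ereal) \<Rightarrow> ('w \<Rightarrow> 'e)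
      \<Rightarrow> ('w \<Rightarrow> 'e \<Rightarrow>\<^sub>L real) set"
  where "L1_frechet_subdifferential M f x0 = {xs \<in> L1_weak_star M.
    AE w in M. blinfun_apply (xs w) \<in> frechet_subdifferential UNIV norm (f w) (x0 w)}"

end

theory Submission
  imports Defs
begin

text \<open>
  Let \<open>x\<^sup>*\<close> be an integrable selection of the pointwise subdifferentials and let \<open>y\<^sub>n \<rightarrow> x\<^sub>0\<close> in
  \<open>L\<^sub>\<infinity>\<close> with distances \<open>N\<^sub>n > 0\<close>. Measure by how much the inequality
  \<open>f(y\<^sub>n) \<ge> f(x\<^sub>0) + \<langle>x\<^sup>*, y\<^sub>n - x\<^sub>0\<rangle>\<close> fails at \<open>\<omega>\<close>, relative to \<open>N\<^sub>n\<close>, by the normalized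
  deficit
  \<open>k\<^sub>n = (f(x\<^sub>0) + \<langle>x\<^sup>*, y\<^sub>n - x\<^sub>0\<rangle> - f(y\<^sub>n))\<^sup>+ / N\<^sub>n\<close>. The Frechet condition at almost every
  \<open>\<omega>\<close>, together with \<open>\<parallel>y\<^sub>n(\<omega>) - x\<^sub>0(\<omega>)\<parallel> \<le> N\<^sub>n\<close>, gives \<open>k\<^sub>n \<rightarrow> 0\<close> almost everywhere, and the
  growth hypothesis gives \<open>k\<^sub>n \<le> \<bar>c\<bar> + \<parallel>x\<^sup>*\<parallel>\<close> as soon as \<open>N\<^sub>n \<le> \<eta>\<close>. Dominated convergence
  then yields \<open>\<integral> k\<^sub>n \<rightarrow> 0\<close>. Since \<open>f(y\<^sub>n) \<ge> f(x\<^sub>0) + \<langle>x\<^sup>*, y\<^sub>n - x\<^sub>0\<rangle> - N\<^sub>n k\<^sub>n\<close> and the right-hand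
  side is integrable, its integral is a lower bound for the upper integral of \<open>f(y\<^sub>n)\<close>, so the
  difference quotient of \<open>I\<^sub>f\<close> at \<open>y\<^sub>n\<close> is at least \<open>- \<integral> k\<^sub>n\<close>. This is
  \<open>integral_functional_frechet_growth\<close>.

  Working along a sequence keeps everything measurable at no cost: each \<open>k\<^sub>n\<close> is built from
  the measurable function \<open>f(y\<^sub>n)\<close>. The natural direct argument, which dominates the deficits
  uniformly over a ball, would involve a supremum over uncountably many \<open>e \<in> E\<close> and a measurable
  projection theorem.

  That \<open>x\<^sup>*\<close> acts on \<open>L\<^sub>\<infinity>\<close> as a continuous functional (\<open>L1_functional_in_dual\<close>) depends on the
  measurability of \<open>\<omega> \<mapsto> \<langle>x\<^sup>*(\<omega>), x(\<omega>)\<rangle>\<close>, which separability of \<open>E\<close> provides.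
\<close>

section \<open>The Frechet subdifferential without difference quotients\<close>

text \<open>
  Multiplying out the difference quotient puts \<open>J y\<close> alone on one side of an inequality whose other
  side is finite, so that infinite values of \<open>J\<close> need no case distinction afterwards. Both the
  pointwise hypothesis (on \<open>E\<close>) and the conclusion (on \<open>L\<^sub>\<infinity>\<close>) are used in this form.
\<close>

lemma frechet_subdifferential_iff_eps_delta:
  "l \<in> frechet_subdifferential Y N J y0 \<longleftrightarrow>
    l \<in> dual_on Y N \<and> \<bar>J y0\<bar> \<noteq> \<infinity> \<and>
    (\<forall>\<epsilon>>0. \<exists>\<delta>>0. \<forall>y\<in>Y. 0 < N (y - y0) \<and> N (y - y0) < \<delta> \<longrightarrow>
      J y0 + ereal (l (y - y0) - \<epsilon> * N (y - y0)) \<le> J y)"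
    (is "_ \<longleftrightarrow> _ \<and> _ \<and> ?R")
proof -
  let ?q = "\<lambda>y. (J y - J y0 - ereal (l (y - y0))) / ereal (N (y - y0))"
  have "0 \<le> Liminf (at_on Y N y0) ?q \<longleftrightarrow> ?R" if fin: "\<bar>J y0\<bar> \<noteq> \<infinity>"
  proof -
    obtain r where r: "J y0 = ereal r" using fin by auto
    have ev: "eventually P (at_on Y N y0) \<longleftrightarrow>
        (\<exists>\<delta>>0. \<forall>y\<in>Y. 0 < N (y - y0) \<and> N (y - y0) < \<delta> \<longrightarrow> P y)" for P
    proof
      assume "eventually P (at_on Y N y0)"
      then obtain Q where Q: "eventually Q (at_right (0::real))"
        "\<And>y. Q (N (y - y0)) \<Longrightarrow> y \<in> Y \<Longrightarrow> P y"
        by (auto simp: at_on_def eventually_filtercomap eventually_inf_principal)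
      then show "\<exists>\<delta>>0. \<forall>y\<in>Y. 0 < N (y - y0) \<and> N (y - y0) < \<delta> \<longrightarrow> P y"
        unfolding eventually_at_right_field by blast
    next
      assume "\<exists>\<delta>>0. \<forall>y\<in>Y. 0 < N (y - y0) \<and> N (y - y0) < \<delta> \<longrightarrow> P y"
      then obtain \<delta> where \<delta>: "\<delta> > 0"
        "\<And>y. y \<in> Y \<Longrightarrow> 0 < N (y - y0) \<Longrightarrow> N (y - y0) < \<delta> \<Longrightarrow> P y" by blast
      have "eventually (\<lambda>t. 0 < t \<and> t < \<delta>) (at_right (0::real))"
        unfolding eventually_at_right_field using \<delta>(1) by auto
      then show "eventually P (at_on Y N y0)"
        using \<delta>(2) by (auto simp: at_on_def eventually_filtercomap eventually_inf_principal)
    qed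
    have quot: "ereal (- \<epsilon>) \<le> (a - ereal r - ereal s) / ereal n \<longleftrightarrow>
        ereal r + ereal (s - \<epsilon> * n) \<le> a" if "n > 0" for a s n \<epsilon>
      using that by (cases a) (auto simp: field_simps)
    show ?thesis
    proof
      assume L: "0 \<le> Liminf (at_on Y N y0) ?q"
      show ?R
      proof (intro allI impI)
        fix \<epsilon> :: real assume "\<epsilon> > 0"
        then have "ereal (- \<epsilon>) < Liminf (at_on Y N y0) ?q"
          using L by (intro less_le_trans[OF _ L]) simp
        then have "eventually (\<lambda>y. ereal (- \<epsilon>) < ?q y) (at_on Y N y0)"
          by (rule less_LiminfD)
        then obtain \<delta> where "\<delta> > 0"
          and \<delta>: "\<And>y. y \<in> Y \<Longrightarrow> 0 < N (y - y0) \<Longrightarrow> N (y - y0) < \<delta> \<Longrightarrow> ereal (- \<epsilon>) < ?q y"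
          unfolding ev by blast
        have "J y0 + ereal (l (y - y0) - \<epsilon> * N (y - y0)) \<le> J y"
          if "y \<in> Y" "0 < N (y - y0)" "N (y - y0) < \<delta>" for y
          using quot[OF that(2), of \<epsilon> "J y" "l (y - y0)"] less_imp_le[OF \<delta>[OF that]]
          unfolding r by (rule iffD1)
        with \<open>\<delta> > 0\<close> show "\<exists>\<delta>>0. \<forall>y\<in>Y. 0 < N (y - y0) \<and> N (y - y0) < \<delta> \<longrightarrow>
            J y0 + ereal (l (y - y0) - \<epsilon> * N (y - y0)) \<le> J y"
          by blast
      qed
    next
      assume R: ?R
      show "0 \<le> Liminf (at_on Y N y0) ?q"
      proof (rule ereal_le_epsilon2)
        fix \<epsilon> :: real assume "\<epsilon> > 0"
        then obtain \<delta> where "\<delta> > 0"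
          and \<delta>: "\<And>y. y \<in> Y \<Longrightarrow> 0 < N (y - y0) \<Longrightarrow> N (y - y0) < \<delta> \<Longrightarrow>
            J y0 + ereal (l (y - y0) - \<epsilon> * N (y - y0)) \<le> J y"
          using R by blast
        have "ereal (- \<epsilon>) \<le> ?q y" if "y \<in> Y" "0 < N (y - y0)" "N (y - y0) < \<delta>" for y
          using quot[OF that(2), of \<epsilon> "J y" "l (y - y0)"] \<delta>[OF that]
          unfolding r by (rule iffD2)
        with \<open>\<delta> > 0\<close> have "eventually (\<lambda>y. ereal (- \<epsilon>) \<le> ?q y) (at_on Y N y0)"
          unfolding ev by blast
        then have "ereal (- \<epsilon>) \<le> Liminf (at_on Y N y0) ?q"
          by (rule Liminf_bounded)
        then show "0 \<le> Liminf (at_on Y N y0) ?q + ereal \<epsilon>"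
          by (cases "Liminf (at_on Y N y0) ?q") (auto simp: zero_ereal_def)
      qed
    qed
  qed
  then show ?thesis
    by (auto simp: frechet_subdifferential_def)
qed

section \<open>The pairing of weak-star integrable and essentially bounded functions\<close>

lemma AE_norm_le_Linf_norm:
  assumes "x \<in> Linf M"
  shows "AE w in M. norm (x w) \<le> Linf_norm M x"
proof -
  let ?S = "esssup M (\<lambda>w. ereal (norm (x w)))"
  have [measurable]: "x \<in> borel_measurable M" and "?S < \<infinity>"
    using assms by (auto simp: Linf_def)
  have "AE w in M. ereal (norm (x w)) \<le> ?S"
    by (rule esssup_AE)
  then show ?thesis
    using \<open>?S < \<infinity>\<close> unfolding Linf_norm_def
    by (cases ?S) auto
qed

lemma Linf_diff:
  fixes x y :: "'w \<Rightarrow> 'e::{real_normed_vector, second_countable_topology}"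
  assumes "x \<in> Linf M" "y \<in> Linf M"
  shows "x - y \<in> Linf M"
proof -
  have [measurable]: "x \<in> borel_measurable M" "y \<in> borel_measurable M"
    using assms by (auto simp: Linf_def)
  have "AE w in M. ereal (norm ((x - y) w)) \<le> ereal (Linf_norm M x + Linf_norm M y)"
    using AE_norm_le_Linf_norm[OF assms(1)] AE_norm_le_Linf_norm[OF assms(2)]
  proof eventually_elim
    case (elim w)
    then show ?case using norm_triangle_ineq4[of "x w" "y w"] by simp
  qed
  then have "esssup M (\<lambda>w. ereal (norm ((x - y) w))) \<le> ereal (Linf_norm M x + Linf_norm M y)"
    by (intro esssup_I) (auto simp: fun_diff_def)
  then show ?thesis
    unfolding Linf_def by (auto simp: fun_diff_def)
qed

text \<open>
  For a simple \<open>x\<close> the pairing is a finite sum of scalar functions \<open>\<langle>x\<^sup>*(\<cdot>), e\<rangle>\<close> cut off to measurable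
  sets. Separability makes a Borel function a pointwise limit of simple ones, and each \<open>x\<^sup>*(\<omega>)\<close> is
  continuous.
\<close>

lemma borel_measurable_weak_star_apply:
  fixes xs :: "'w \<Rightarrow> 'e::{real_normed_vector, second_countable_topology} \<Rightarrow>\<^sub>L real"
  assumes xs: "\<And>e. (\<lambda>w. blinfun_apply (xs w) e) \<in> borel_measurable M"
    and x: "x \<in> borel_measurable M"
  shows "(\<lambda>w. blinfun_apply (xs w) (x w)) \<in> borel_measurable M"
proof -
  obtain s where s: "\<And>n. simple_function M (s n)" "\<And>w. w \<in> space M \<Longrightarrow> (\<lambda>n. s n w) \<longlonglongrightarrow> x w"
    using borel_measurable_implies_sequence_metric[OF x, of 0] by blast
  have "(\<lambda>w. blinfun_apply (xs w) (s n w)) \<in> borel_measurable M" for n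
  proof -
    have "(\<lambda>w. \<Sum>e\<in>s n ` space M. indicator (s n -` {e} \<inter> space M) w * blinfun_apply (xs w) e)
        \<in> borel_measurable M"
      using simple_functionD(2)[OF s(1), of n]
      by (intro borel_measurable_sum borel_measurable_times xs borel_measurable_indicator) auto
    moreover have "blinfun_apply (xs w) (s n w) =
        (\<Sum>e\<in>s n ` space M. indicator (s n -` {e} \<inter> space M) w * blinfun_apply (xs w) e)"
      if "w \<in> space M" for w
      using that simple_functionD(1)[OF s(1), of n]
      by (subst sum.remove[of _ "s n w"]) (auto intro!: sum.neutral simp: indicator_def)
    ultimately show ?thesis by (subst measurable_cong) auto
  qed
  then show ?thesis
    by (rule borel_measurable_LIMSEQ_real[where u = "\<lambda>n w. blinfun_apply (xs w) (s n w)", rotated])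
      (intro blinfun.tendsto tendsto_const s(2))
qed

lemma integrable_weak_star_apply:
  fixes xs :: "'w \<Rightarrow> 'e::{real_normed_vector, second_countable_topology} \<Rightarrow>\<^sub>L real"
  assumes xs: "xs \<in> L1_weak_star M" and x: "x \<in> Linf M"
  shows "integrable M (\<lambda>w. blinfun_apply (xs w) (x w))"
    and "AE w in M. \<bar>blinfun_apply (xs w) (x w)\<bar> \<le> norm (xs w) * Linf_norm M x"
proof -
  show bnd: "AE w in M. \<bar>blinfun_apply (xs w) (x w)\<bar> \<le> norm (xs w) * Linf_norm M x"
    using AE_norm_le_Linf_norm[OF x]
  proof eventually_elim
    case (elim w)
    then show ?case
      using norm_blinfun[of "xs w" "x w"] mult_left_mono[OF elim, of "norm (xs w)"] by simp
  qed
  show "integrable M (\<lambda>w. blinfun_apply (xs w) (x w))"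
  proof (rule Bochner_Integration.integrable_bound)
    show "integrable M (\<lambda>w. norm (xs w) * Linf_norm M x)"
      using xs by (simp add: L1_weak_star_def)
    show "(\<lambda>w. blinfun_apply (xs w) (x w)) \<in> borel_measurable M"
      by (rule borel_measurable_weak_star_apply)
        (use xs x in \<open>auto simp: L1_weak_star_def Linf_def\<close>)
    show "AE w in M. norm (blinfun_apply (xs w) (x w)) \<le> norm (norm (xs w) * Linf_norm M x)"
      using bnd by eventually_elim auto
  qed
qed

lemma L1_functional_in_dual:
  fixes xs :: "'w \<Rightarrow> 'e::{real_normed_vector, second_countable_topology} \<Rightarrow>\<^sub>L real"
  assumes xs: "xs \<in> L1_weak_star M"
  shows "L1_functional M xs \<in> dual_on (Linf M) (Linf_norm M)"
proof -
  have "\<bar>L1_functional M xs x\<bar> \<le> (\<integral>w. norm (xs w) \<partial>M) * Linf_norm M x" if x: "x \<in> Linf M" for x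
  proof -
    have "\<bar>L1_functional M xs x\<bar> \<le> (\<integral>w. \<bar>blinfun_apply (xs w) (x w)\<bar> \<partial>M)"
      unfolding L1_functional_def by (rule integral_abs_bound)
    also have "\<dots> \<le> (\<integral>w. norm (xs w) * Linf_norm M x \<partial>M)"
      using integrable_weak_star_apply[OF xs x] xs
      by (intro integral_mono_AE) (auto simp: L1_weak_star_def)
    finally show ?thesis by simp
  qed
  then show ?thesis
    using integrable_weak_star_apply(1)[OF xs]
    by (auto simp: dual_on_def L1_functional_def blinfun.add_right blinfun.scaleR_right
        scaleR_fun_def)
qed

section \<open>The upper integral and integrable functions\<close>

lemma upper_integral_ge:
  assumes "integrable M g" "AE w in M. ereal (g w) \<le> v w"
  shows "ereal (\<integral>w. g w \<partial>M) \<le> upper_integral M v"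
  unfolding upper_integral_def
proof (rule Inf_greatest, clarify)
  fix u assume u: "integrable M u" "AE w in M. v w \<le> ereal (u w)"
  have "AE w in M. g w \<le> u w"
    using assms(2) u(2)
  proof eventually_elim
    case (elim w)
    then have "ereal (g w) \<le> ereal (u w)" by (rule order_trans)
    then show ?case by simp
  qed
  then show "ereal (integral\<^sup>L M g) \<le> ereal (integral\<^sup>L M u)"
    using assms(1) u(1) by (simp add: integral_mono_AE)
qed

lemma upper_integral_eq_integral:
  assumes "integrable M g" "AE w in M. v w = ereal (g w)"
  shows "upper_integral M v = ereal (\<integral>w. g w \<partial>M)"
proof (rule antisym)
  show "upper_integral M v \<le> ereal (\<integral>w. g w \<partial>M)"
    unfolding upper_integral_def using assms
    by (intro Inf_lower CollectI exI[of _ g] conjI refl) auto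
  show "ereal (\<integral>w. g w \<partial>M) \<le> upper_integral M v"
    using assms(2) by (intro upper_integral_ge assms(1)) auto
qed

lemma ereal_integrableD:
  assumes "ereal_integrable M v"
  shows "integrable M (\<lambda>w. real_of_ereal (v w))"
    and "AE w in M. v w = ereal (real_of_ereal (v w))"
proof -
  have [measurable]: "v \<in> borel_measurable M"
    and fin: "(\<integral>\<^sup>+w. e2ennreal \<bar>v w\<bar> \<partial>M) < \<infinity>"
    using assms by (auto simp: ereal_integrable_def)
  have "AE w in M. e2ennreal \<bar>v w\<bar> \<noteq> \<infinity>"
    using fin by (intro nn_integral_noteq_infinite) auto
  then show ae: "AE w in M. v w = ereal (real_of_ereal (v w))"
  proof eventually_elim
    case (elim w)
    then have "\<bar>v w\<bar> \<noteq> \<infinity>" by (auto simp: e2ennreal_infty)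
    then show ?case by (simp add: ereal_real)
  qed
  have "(\<integral>\<^sup>+w. ennreal (norm (real_of_ereal (v w))) \<partial>M) = (\<integral>\<^sup>+w. e2ennreal \<bar>v w\<bar> \<partial>M)"
    using ae
  proof (intro nn_integral_cong_AE, eventually_elim)
    case (elim w)
    have "\<exists>r. v w = ereal r" by (rule exI) (rule elim)
    then show ?case by auto
  qed
  then show "integrable M (\<lambda>w. real_of_ereal (v w))"
    using fin by (intro integrableI_bounded) auto
qed

section \<open>Frechet growth of the integral functional\<close>

text \<open>
  The positive part of \<open>a - v\<close>, taken in the extended reals before passing to \<open>real\<close> so that
  \<open>v = \<infinity>\<close> gives no deficit. A bound \<open>a - b \<le> v\<close> excludes \<open>v = -\<infinity>\<close>.
\<close>

lemma real_deficit_bounds: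
  fixes a b :: real and v :: ereal
  assumes "ereal (a - b) \<le> v" "0 \<le> b"
  shows "0 \<le> real_of_ereal (max 0 (ereal a - v))"
    and "real_of_ereal (max 0 (ereal a - v)) \<le> b"
    and "ereal (a - real_of_ereal (max 0 (ereal a - v))) \<le> v"
proof -
  have "0 \<le> real_of_ereal (max 0 (ereal a - v)) \<and> real_of_ereal (max 0 (ereal a - v)) \<le> b
      \<and> ereal (a - real_of_ereal (max 0 (ereal a - v))) \<le> v"
  proof (cases v)
    case (real r)
    then have "real_of_ereal (max 0 (ereal a - v)) = max 0 (a - r)"
      by (simp add: max_def zero_ereal_def)
    then show ?thesis
      using assms real by auto
  next
    case PInf
    then show ?thesis
      using assms by (simp add: max_def)
  next
    case MInf
    then show ?thesis
      using assms by simp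
  qed
  then show "0 \<le> real_of_ereal (max 0 (ereal a - v))"
    and "real_of_ereal (max 0 (ereal a - v)) \<le> b"
    and "ereal (a - real_of_ereal (max 0 (ereal a - v))) \<le> v"
    by auto
qed

text \<open>
  If the claim fails for \<open>\<epsilon>\<close>, there is a sequence \<open>y\<^sub>n \<rightarrow> x\<^sub>0\<close> in \<open>L\<^sub>\<infinity>\<close> violating it. Along this sequence
  the integrals of the normalized deficits converge to 0 by dominated convergence, whereas the
  violation forces each of them to be at least \<open>\<epsilon>\<close>.
\<close>

lemma integral_functional_frechet_growth:
  fixes M :: "'w measure"
    and f :: "'w \<Rightarrow> 'e::{real_normed_vector, second_countable_topology} \<Rightarrow> ereal"
  assumes x0: "x0 \<in> Linf M"
    and f: "measurable_integrand M f"
    and fx0: "ereal_integrable M (\<lambda>w. f w (x0 w))"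
    and "\<eta> > 0" and c: "integrable M c"
    and growth: "AE w in M. \<forall>e. norm e \<le> \<eta> \<longrightarrow>
        f w (x0 w + e) - f w (x0 w) \<ge> ereal (- c w * norm e)"
    and xs: "xs \<in> L1_frechet_subdifferential M f x0"
    and "\<epsilon> > 0"
  shows "\<exists>\<delta>>0. \<forall>y\<in>Linf M. 0 < Linf_norm M (y - x0) \<and> Linf_norm M (y - x0) < \<delta> \<longrightarrow>
      integral_functional M f x0
        + ereal (L1_functional M xs (y - x0) - \<epsilon> * Linf_norm M (y - x0))
      \<le> integral_functional M f y"
proof (rule ccontr)
  assume contra: "\<not> ?thesis"
  have "\<exists>y. y \<in> Linf M \<and> 0 < Linf_norm M (y - x0) \<and>
      Linf_norm M (y - x0) < \<eta> * inverse (real (Suc n)) \<and>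
      \<not> integral_functional M f x0
        + ereal (L1_functional M xs (y - x0) - \<epsilon> * Linf_norm M (y - x0))
      \<le> integral_functional M f y" for n
  proof -
    have "\<eta> * inverse (real (Suc n)) > 0" using \<open>\<eta> > 0\<close> by simp
    then show ?thesis using contra by blast
  qed
  then obtain y where y: "\<And>n. y n \<in> Linf M"
    and N_pos: "\<And>n. 0 < Linf_norm M (y n - x0)"
    and N_less: "\<And>n. Linf_norm M (y n - x0) < \<eta> * inverse (real (Suc n))"
    and bad: "\<And>n. \<not> integral_functional M f x0
        + ereal (L1_functional M xs (y n - x0) - \<epsilon> * Linf_norm M (y n - x0))
      \<le> integral_functional M f (y n)"
    by metis
  \<comment> \<open>\<open>a n\<close> is the affine minorant that the subgradient predicts for \<open>f\<close> at \<open>y n\<close>, \<open>k n\<close> the deficit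
    with respect to it, relative to the distance, and \<open>h\<close> the dominating function.\<close>
  define N where "N n = Linf_norm M (y n - x0)" for n
  define a where "a n w = real_of_ereal (f w (x0 w)) + blinfun_apply (xs w) (y n w - x0 w)" for n w
  define k where "k n w = real_of_ereal (max 0 (ereal (a n w) - f w (y n w))) / N n" for n w
  define h where "h w = \<bar>c w\<bar> + norm (xs w)" for w

  have Npos: "N n > 0" for n using N_pos by (simp add: N_def)
  have N\<eta>: "N n \<le> \<eta>" for n
  proof -
    have "\<eta> * inverse (real (Suc n)) \<le> \<eta> * 1"
      using \<open>\<eta> > 0\<close> by (intro mult_left_mono) (auto simp: field_simps)
    then show ?thesis using N_less[of n] by (simp add: N_def)
  qed
  have N0: "N \<longlonglongrightarrow> 0"
  proof (rule tendsto_sandwich)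
    show "\<forall>\<^sub>F n in sequentially. 0 \<le> N n" using Npos by (simp add: less_imp_le)
    show "\<forall>\<^sub>F n in sequentially. N n \<le> \<eta> * inverse (real (Suc n))"
      using N_less by (simp add: N_def less_imp_le)
    show "(\<lambda>n. \<eta> * inverse (real (Suc n))) \<longlonglongrightarrow> 0"
      using tendsto_mult_right_zero[OF LIMSEQ_inverse_real_of_nat] by simp
  qed simp

  have xsL1: "xs \<in> L1_weak_star M"
    and sub: "AE w in M. blinfun_apply (xs w) \<in> frechet_subdifferential UNIV norm (f w) (x0 w)"
    using xs by (auto simp: L1_frechet_subdifferential_def)
  note u0 = ereal_integrableD[OF fx0]
  have d: "y n - x0 \<in> Linf M" for n by (rule Linf_diff[OF y x0])
  have int_xs: "integrable M (\<lambda>w. blinfun_apply (xs w) (y n w - x0 w))" for n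
    using integrable_weak_star_apply(1)[OF xsL1 d[of n]] by simp
  have int_a: "integrable M (a n)" for n
    unfolding a_def by (intro Bochner_Integration.integrable_add u0(1) int_xs)
  have int_h: "integrable M h"
    using c xsL1 unfolding h_def by (auto simp: L1_weak_star_def)
  have meas_k: "k n \<in> borel_measurable M" for n
  proof -
    have yn: "y n \<in> borel_measurable M" using y[of n] by (simp add: Linf_def)
    have "(\<lambda>w. (w, y n w)) \<in> M \<rightarrow>\<^sub>M M \<Otimes>\<^sub>M borel"
      using yn by measurable
    from measurable_compose[OF this f[unfolded measurable_integrand_def]]
    have [measurable]: "(\<lambda>w. f w (y n w)) \<in> borel_measurable M" by simp
    have [measurable]: "a n \<in> borel_measurable M"
      using int_a by auto
    show ?thesis unfolding k_def by measurable
  qed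
  have close: "AE w in M. \<forall>n. norm (y n w - x0 w) \<le> N n"
    using AE_norm_le_Linf_norm[OF d] by (simp add: AE_all_countable N_def)

  have k: "AE w in M. (\<forall>n. 0 \<le> k n w \<and> k n w \<le> h w \<and> ereal (a n w - N n * k n w) \<le> f w (y n w))
      \<and> (\<lambda>n. k n w) \<longlonglongrightarrow> 0"
    using u0(2) growth sub close
  proof eventually_elim
    case (elim w)
    define r where "r = real_of_ereal (f w (x0 w))"
    have r: "f w (x0 w) = ereal r" unfolding r_def by (rule elim(1))
    have a: "a n w = r + blinfun_apply (xs w) (y n w - x0 w)" for n by (simp add: a_def r_def)
    have near: "norm (y n w - x0 w) \<le> N n" for n using elim(4) by simp
    have k_bounds: "0 \<le> k n w" "k n w \<le> b" "ereal (a n w - N n * k n w) \<le> f w (y n w)"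
      if "ereal (a n w - b * N n) \<le> f w (y n w)" "0 \<le> b" for n b
      using real_deficit_bounds[OF that(1)] that(2) Npos[of n]
      by (auto simp: k_def pos_divide_le_eq)
    \<comment> \<open>Domination: growth bounds \<open>f(y\<^sub>n)\<close> below, and \<open>\<parallel>x\<^sup>*\<parallel>\<close> absorbs the linear term.\<close>
    have minorant: "ereal (a n w - h w * N n) \<le> f w (y n w)" for n
    proof -
      let ?e = "y n w - x0 w"
      have "ereal (- c w * norm ?e) \<le> f w (y n w) - ereal r"
        using elim(2)[rule_format, of ?e] order_trans[OF near N\<eta>] by (simp add: r)
      then have "ereal (r - c w * norm ?e) \<le> f w (y n w)"
        by (cases "f w (y n w)") auto
      moreover have "blinfun_apply (xs w) ?e \<le> norm (xs w) * norm ?e"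
        using norm_blinfun[of "xs w" ?e] by simp
      moreover have "c w * norm ?e \<le> \<bar>c w\<bar> * norm ?e"
        by (intro mult_right_mono) auto
      moreover have "h w * norm ?e \<le> h w * N n"
        by (intro mult_left_mono near) (simp add: h_def)
      ultimately have "a n w - h w * N n \<le> r - c w * norm ?e"
        by (simp add: a h_def algebra_simps)
      then have "ereal (a n w - h w * N n) \<le> ereal (r - c w * norm ?e)" by simp
      also have "\<dots> \<le> f w (y n w)" by fact
      finally show ?thesis .
    qed
    have h0: "0 \<le> h w" by (simp add: h_def)
    have "(\<lambda>n. k n w) \<longlonglongrightarrow> 0"
    proof (rule LIMSEQ_I)
      fix \<rho> :: real assume "\<rho> > 0"
      then have "\<rho> / 2 > 0" by simp
      then obtain \<delta> where "\<delta> > 0" and \<delta>: "\<And>z. 0 < norm (z - x0 w) \<Longrightarrow> norm (z - x0 w) < \<delta> \<Longrightarrow>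
          f w (x0 w) + ereal (blinfun_apply (xs w) (z - x0 w) - \<rho> / 2 * norm (z - x0 w)) \<le> f w z"
        using elim(3) unfolding frechet_subdifferential_iff_eps_delta by blast
      obtain m where m: "\<And>n. n \<ge> m \<Longrightarrow> N n < \<delta>"
        using order_tendstoD(2)[OF N0 \<open>\<delta> > 0\<close>] by (auto simp: eventually_sequentially)
      have "norm (k n w - 0) < \<rho>" if "n \<ge> m" for n
      proof -
        let ?e = "y n w - x0 w"
        have "ereal (a n w - \<rho> / 2 * norm ?e) \<le> f w (y n w)"
        \<comment> \<open>The Frechet condition concerns the punctured ball only, while \<open>y n\<close> may well agree with
          \<open>x0\<close> at this \<open>w\<close>.\<close>
        proof (cases "?e = 0")
          case True
          then show ?thesis using r by (simp add: a)
        next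
          case False
          then show ?thesis
            using \<delta>[of "y n w"] le_less_trans[OF near m[OF that]] by (simp add: r a add_diff_eq)
        qed
        moreover have "\<rho> / 2 * norm ?e \<le> \<rho> / 2 * N n"
          using near \<open>\<rho> > 0\<close> by (intro mult_left_mono) auto
        ultimately have "ereal (a n w - \<rho> / 2 * N n) \<le> f w (y n w)"
          by (meson diff_left_mono ereal_less_eq(3) order_trans)
        then have "0 \<le> k n w" "k n w \<le> \<rho> / 2"
          using k_bounds[of n "\<rho> / 2"] \<open>\<rho> > 0\<close> by auto
        then show ?thesis using \<open>\<rho> > 0\<close> by simp
      qed
      then show "\<exists>m. \<forall>n\<ge>m. norm (k n w - 0) < \<rho>" by blast
    qed
    then show ?case using k_bounds[OF minorant h0] by blast
  qed

  have k_h: "AE w in M. norm (k n w) \<le> h w" for n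
    using k by eventually_elim (simp add: abs_of_nonneg)
  have k_lim: "AE w in M. (\<lambda>n. k n w) \<longlonglongrightarrow> 0"
    using k by eventually_elim simp
  have int_k: "integrable M (k n)" for n
    using integrable_dominated_convergence2[OF _ meas_k int_h k_lim k_h] by simp
  have "(\<lambda>n. \<integral>w. k n w \<partial>M) \<longlonglongrightarrow> (\<integral>w. 0 \<partial>M)"
    using integral_dominated_convergence[OF _ meas_k int_h k_lim k_h] by simp
  then have "(\<lambda>n. \<integral>w. k n w \<partial>M) \<longlonglongrightarrow> 0" by simp
  then have "eventually (\<lambda>n. (\<integral>w. k n w \<partial>M) < \<epsilon>) sequentially"
    using \<open>\<epsilon> > 0\<close> by (rule order_tendstoD(2))
  then obtain n where n: "(\<integral>w. k n w \<partial>M) < \<epsilon>"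
    by (auto simp: eventually_sequentially)

  have I0: "integral_functional M f x0 = ereal (\<integral>w. real_of_ereal (f w (x0 w)) \<partial>M)"
    unfolding integral_functional_def by (rule upper_integral_eq_integral[OF u0])
  have "integral_functional M f x0 + ereal (L1_functional M xs (y n - x0) - \<epsilon> * N n)
      \<le> ereal ((\<integral>w. a n w \<partial>M) - N n * (\<integral>w. k n w \<partial>M))"
    using Bochner_Integration.integral_add[OF u0(1) int_xs[of n]] n Npos[of n]
    by (simp add: I0 L1_functional_def a_def mult.commute)
  also have "\<dots> = ereal (\<integral>w. a n w - N n * k n w \<partial>M)"
    using int_a int_k by simp
  also have "\<dots> \<le> integral_functional M f (y n)"
    unfolding integral_functional_def
  proof (rule upper_integral_ge)
    show "integrable M (\<lambda>w. a n w - N n * k n w)" using int_a int_k by simp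
    show "AE w in M. ereal (a n w - N n * k n w) \<le> f w (y n w)"
      using k by eventually_elim simp
  qed
  finally show False using bad[of n] by (simp add: N_def)
qed

theorem corollary10p12:
  fixes M :: "'w measure"
    and f :: "'w \<Rightarrow> 'e::{banach, second_countable_topology} \<Rightarrow> ereal"
    and x0 :: "'w \<Rightarrow> 'e"
  assumes "sigma_finite_measure M"
    and "complete_measure M"
    and "x0 \<in> Linf M"
    and "measurable_integrand M f"
    and "ereal_integrable M (\<lambda>w. f w (x0 w))"
    and "\<exists>\<eta>::real. \<eta> > 0 \<and> (\<exists>c :: 'w \<Rightarrow> real. integrable M c \<and>
      (AE w in M. \<forall>e. norm e \<le> \<eta> \<longrightarrow>
        f w (x0 w + e) - f w (x0 w) \<ge> ereal (- c w * norm e)))"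
  shows "L1_functional M ` L1_frechet_subdifferential M f x0
    \<subseteq> frechet_subdifferential (Linf M) (Linf_norm M) (integral_functional M f) x0"
proof clarify
  fix xs assume xs: "xs \<in> L1_frechet_subdifferential M f x0"
  obtain \<eta> c where "\<eta> > 0" "integrable M c" and growth: "AE w in M. \<forall>e. norm e \<le> \<eta> \<longrightarrow>
      f w (x0 w + e) - f w (x0 w) \<ge> ereal (- c w * norm e)"
    using assms(6) by blast
  show "L1_functional M xs
      \<in> frechet_subdifferential (Linf M) (Linf_norm M) (integral_functional M f) x0"
    unfolding frechet_subdifferential_iff_eps_delta
  proof (intro conjI allI impI)
    show "L1_functional M xs \<in> dual_on (Linf M) (Linf_norm M)"
      using xs by (intro L1_functional_in_dual) (simp add: L1_frechet_subdifferential_def)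
    show "\<bar>integral_functional M f x0\<bar> \<noteq> \<infinity>"
      using upper_integral_eq_integral[OF ereal_integrableD[OF assms(5)]]
      by (simp add: integral_functional_def)
  qed (rule integral_functional_frechet_growth[OF assms(3-5) \<open>\<eta> > 0\<close> \<open>integrable M c\<close> growth xs])
qed

end
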